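(* For a single-layer RCNN with $\bm\lambda_t$ being a constant or depending only on $x_t$, the recurrence is rational (over the real semiring). Explicitly: let $n\ge1$, let $\Sigma$ be a finite alphabet, let each $\alpha\in\Sigma$ have an embedding vector $\mathbf{v}(\alpha)\in\mathbb{R}^m$, and for $\mathbf{x}=x_1\dots x_N\in\Sigma^\ast$ put $\mathbf{v}_t=\mathbf{v}(x_t)$, $\mathbf{c}_0^{(j)}=\mathbf{0}\in\mathbb{R}^d$ for $1\le j\le n$, and for $1\le t\le N$ $$\mathbf{c}_t^{(1)}=\mathbf{c}_{t-1}^{(1)}\odot\bm\lambda_t+\mathbf{u}_t^{(1)},\qquad \mathbf{c}_t^{(j)}=\mathbf{c}_{t-1}^{(j)}\odot\bm\lambda_t+\mathbf{c}_{t-1}^{(j-1)}\odot\mathbf{u}_t^{(j)}\quad(2\le j\le n),$$ where $\mathbf{u}_t^{(j)}=(\mathbf{1}-\bm\lambda_t)\odot\bm g(\mathbf{W}_u^{(j)}\mathbf{v}_t+\mathbf{b}_u^{(j)})$ with $\mathbf{W}_u^{(j)}\in\mathbb{R}^{d\times m}$, $\mathbf{b}_u^{(j)}\in\mathbb{R}^d$ and $\bm g$ an elementwise function. If $\bm\lambda_t\in\mathbb{R}^d$ is either a constant vector or a function of the symbol $x_t$ only, then the recurrence of the function $\mathbf{c}:\Sigma^\ast\to\mathbb{R}^d$, $\mathbf{c}(\mathbf{x})=\mathbf{c}_N^{(n)}$, is rational.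
   Context: RCNN = recurrent convolutional neural network ($n$-gram version; the case $n=2$ is the bigram version); $\mathbf{c}_t^{(n)}$ is the state used for onward computation. $\odot$ is the elementwise product and $\mathbf 1$ the all-ones vector. A weighted finite-state automaton (WFSA) over a semiring $\langle\mathbb{K},\oplus,\otimes,\bar0,\bar1\rangle$ is a tuple $\mathscr{A}=\langle\Sigma,\mathcal{Q},\tau,\lambda,\rho\rangle$ with finite alphabet $\Sigma$, finite state set $\mathcal{Q}$, transition weights $\tau:\mathcal{Q}\times\mathcal{Q}\times(\Sigma\cup\{\varepsilon\})\to\mathbb{K}$ (with $\varepsilon\notin\Sigma$ marking transitions that consume no input), initial weights $\lambda:\mathcal{Q}\to\mathbb{K}$ and final weights $\rho:\mathcal{Q}\to\mathbb{K}$. A path $\bm\pi=\pi_1\dots\pi_\ell$ is a sequence of adjacent transitions $\pi_k=(q_k,q_{k+1},z_k)$; it derives the string obtained from $z_1\dots z_\ell$ by deleting all $\varepsilon$'s (a path with no transitions sits at a single state $q_1$ and derives the empty string). Its score is $\mathscr{A}[\bm\pi]=\lambda(q_1)\otimes\bigl(\bigotimes_{k=1}^\ell\tau(\pi_k)\bigr)\otimes\rho(q_{\ell+1})$. The score of a string $\mathbf{x}$ is $\mathscr{A}\llbracket\mathbf{x}\rrbracket=\bigoplus_{\bm\pi}\mathscr{A}[\bm\pi]$, summed over all paths deriving $\mathbf{x}$ (transitions of weight $\bar0$ are regarded as absent; if there is a cycle of $\varepsilon$-transitions, the number of consecutive $\varepsilon$-transitions must be capped or infinite sums must make sense in $\mathbb{K}$).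 Rational recurrence: the recurrence of a function $\mathbf{c}:\Sigma^\ast\to\mathbb{K}^d$ is rational if there is a set of WFSAs $\{\mathscr{A}_i\}_{i=1}^d$ over alphabet $\Sigma$ and semiring $\langle\mathbb{K},\oplus,\otimes,\bar0,\bar1\rangle$, with $\oplus$ and $\otimes$ taking constant time and space, such that $[\mathbf{c}(\mathbf{x})]_i=\mathscr{A}_i\llbracket\mathbf{x}\rrbracket$ for all $\mathbf{x}\in\Sigma^\ast$ and all $i\in\{1,\dots,d\}$. Here $\mathbb{K}=\mathbb{R}$ carries the real semiring $\langle\mathbb{R},+,\cdot,0,1\rangle$, whose operations are counted as constant time and space. *)

theory Defs
  imports "HOL-Analysis.Analysis"
begin

(* Transitions are labelled by 'a option; the label None is epsilon.
   The fields tweight, iweight, fweight are tau, lambda, rho. *)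
record ('a, 'q, 'k) wfsa =
  alphabet :: "'a set"
  states :: "'q set"
  tweight :: "'q \<Rightarrow> 'q \<Rightarrow> 'a option \<Rightarrow> 'k"
  iweight :: "'q \<Rightarrow> 'k"
  fweight :: "'q \<Rightarrow> 'k"

definition is_wfsa :: "('a, 'q, 'k) wfsa \<Rightarrow> bool" where
  "is_wfsa A \<longleftrightarrow> finite (alphabet A) \<and> finite (states A)"

type_synonym ('a, 'q) transition = "'q \<times> 'q \<times> 'a option"

(* A path is given by its first state p together with its list of transitions, so that
   the paths without transitions are the states. Transitions of weight 0 are absent. *)
fun is_path :: "('a, 'q, 'k::semiring_1) wfsa \<Rightarrow> 'q \<Rightarrow> ('a, 'q) transition list \<Rightarrow> bool" where
  "is_path A p [] \<longleftrightarrow> p \<in> states A"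
| "is_path A p ((p', q, z) # ts) \<longleftrightarrow>
     p' = p \<and> p \<in> states A \<and> z \<in> insert None (Some ` alphabet A) \<and>
     tweight A p q z \<noteq> 0 \<and> is_path A q ts"

fun path_end :: "'q \<Rightarrow> ('a, 'q) transition list \<Rightarrow> 'q" where
  "path_end p [] = p"
| "path_end p ((p', q, z) # ts) = path_end q ts"

definition derived_string :: "('a, 'q) transition list \<Rightarrow> 'a list" where
  "derived_string ts = List.map_filter (\<lambda>(p, q, z). z) ts"

definition path_score ::
    "('a, 'q, 'k::semiring_1) wfsa \<Rightarrow> 'q \<Rightarrow> ('a, 'q) transition list \<Rightarrow> 'k" where
  "path_score A p ts =
     iweight A p * prod_list (map (\<lambda>(p, q, z). tweight A p q z) ts) * fweight A (path_end p ts)"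

definition string_paths ::
    "('a, 'q, 'k::semiring_1) wfsa \<Rightarrow> 'a list \<Rightarrow> ('q \<times> ('a, 'q) transition list) set" where
  "string_paths A x = {(p, ts). is_path A p ts \<and> derived_string ts = x}"

definition string_score :: "('a, 'q, 'k::semiring_1) wfsa \<Rightarrow> 'a list \<Rightarrow> 'k" where
  "string_score A x = (\<Sum>(p, ts)\<in>string_paths A x. path_score A p ts)"

(* States are taken from nat, which is no restriction for finite state sets.
   Finiteness of string_paths makes string_score a genuine sum: for a finite automaton it
   holds for every string iff there is no cycle of epsilon-transitions of nonzero weight,
   so neither a cap on consecutive epsilon-transitions nor an infinite sum is needed. *)
definition rational_recurrence ::
    "'a set \<Rightarrow> ('a list \<Rightarrow> ('k::semiring_1) ^ 'd) \<Rightarrow> bool" where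
  "rational_recurrence \<Sigma> c \<longleftrightarrow>
     (\<exists>A :: 'd \<Rightarrow> ('a, nat, 'k) wfsa. \<forall>i.
        is_wfsa (A i) \<and> alphabet (A i) = \<Sigma> \<and>
        (\<forall>x\<in>lists \<Sigma>. finite (string_paths (A i) x) \<and> c x $ i = string_score (A i) x))"

(* On vectors, * is the elementwise product and 1 is the all-ones vector.
   The argument lam is the vector lambda_t of the current time step, y is v_t. *)
definition rcnn_input ::
    "(real \<Rightarrow> real) \<Rightarrow> (nat \<Rightarrow> real ^ 'm ^ 'd) \<Rightarrow> (nat \<Rightarrow> real ^ 'd)
      \<Rightarrow> real ^ 'd \<Rightarrow> real ^ 'm \<Rightarrow> nat \<Rightarrow> real ^ 'd" where
  "rcnn_input g W b lam y j = (1 - lam) * (\<chi> i. g ((W j *v y + b j) $ i))"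

(* rcnn_state g W b v lam x t j is c_t^(j) on the input string x, for j \<ge> 1.
   The vector lambda_t is lam x t, where t counts from 1; since lists are indexed from 0,
   the symbol x_(Suc t) is x ! t. *)
primrec rcnn_state ::
    "(real \<Rightarrow> real) \<Rightarrow> (nat \<Rightarrow> real ^ 'm ^ 'd) \<Rightarrow> (nat \<Rightarrow> real ^ 'd) \<Rightarrow> ('a \<Rightarrow> real ^ 'm)
      \<Rightarrow> ('a list \<Rightarrow> nat \<Rightarrow> real ^ 'd) \<Rightarrow> 'a list \<Rightarrow> nat \<Rightarrow> nat \<Rightarrow> real ^ 'd" where
  "rcnn_state g W b v lam x 0 = (\<lambda>j. 0)"
| "rcnn_state g W b v lam x (Suc t) = (\<lambda>j.
     rcnn_state g W b v lam x t j * lam x (Suc t) +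
     (if j = 1 then rcnn_input g W b (lam x (Suc t)) (v (x ! t)) 1
      else rcnn_state g W b v lam x t (j - 1) * rcnn_input g W b (lam x (Suc t)) (v (x ! t)) j))"

definition rcnn ::
    "nat \<Rightarrow> (real \<Rightarrow> real) \<Rightarrow> (nat \<Rightarrow> real ^ 'm ^ 'd) \<Rightarrow> (nat \<Rightarrow> real ^ 'd) \<Rightarrow> ('a \<Rightarrow> real ^ 'm)
      \<Rightarrow> ('a list \<Rightarrow> nat \<Rightarrow> real ^ 'd) \<Rightarrow> 'a list \<Rightarrow> real ^ 'd" where
  "rcnn n g W b v lam x = rcnn_state g W b v lam x (length x) n"

end

theory Submission
  imports Defs
begin

text \<open>
  Take the states 0, ..., n, where state 0 loops on every symbol with weight 1, state j \<ge> 1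
  loops on a with weight lambda(a), and j - 1 moves to j on a with weight u^(j)(a). A path from 0
  to n thus selects the positions at which the n factors of an n-gram are read. Without
  epsilon-transitions the score of a string is a product of transition matrices, so it can be
  computed by a forward recurrence over the string. For the automaton above the forward weights
  of the states 1, ..., n after t symbols are the coordinates of c_t^(1), ..., c_t^(n), and the
  constant forward weight 1 of state 0 makes the equation for c_t^(1) a case of the general one.
\<close>

definition epsilon_free :: "('a, 'q, 'k::semiring_1) wfsa \<Rightarrow> bool" where
  "epsilon_free A \<longleftrightarrow> (\<forall>p q. tweight A p q None = 0)"

definition paths_from ::
    "('a, 'q, 'k::semiring_1) wfsa \<Rightarrow> 'q \<Rightarrow> 'a list \<Rightarrow> ('a, 'q) transition list set" where
  "paths_from A p x = {ts. is_path A p ts \<and> derived_string ts = x}"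

text \<open>The initial weight is left out so that splitting off the first transition gives a
  recursion of the same form.\<close>

definition suffix_score ::
    "('a, 'q, 'k::semiring_1) wfsa \<Rightarrow> 'q \<Rightarrow> ('a, 'q) transition list \<Rightarrow> 'k" where
  "suffix_score A p ts =
     prod_list (map (\<lambda>(p, q, z). tweight A p q z) ts) * fweight A (path_end p ts)"

text \<open>This is the row vector \<open>\<alpha>\<close> times the transition matrix of
  \<open>a\<close>.\<close>

definition forward_step ::
    "('a, 'q, 'k::semiring_1) wfsa \<Rightarrow> ('q \<Rightarrow> 'k) \<Rightarrow> 'a \<Rightarrow> 'q \<Rightarrow> 'k" where
  "forward_step A \<alpha> a = (\<lambda>q. \<Sum>p\<in>states A. \<alpha> p * tweight A p q (Some a))"

lemma derived_string_simps [simp]: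
  "derived_string [] = []"
  "derived_string ((p, q, Some a) # ts) = a # derived_string ts"
  by (simp_all add: derived_string_def)

lemma is_path_start: "is_path A p ts \<Longrightarrow> p \<in> states A"
  by (cases ts) auto

lemma string_paths_eq_Sigma: "string_paths A x = (SIGMA p:states A. paths_from A p x)"
  by (auto simp: string_paths_def paths_from_def dest: is_path_start)

lemma paths_from_Nil:
  assumes "epsilon_free A" "p \<in> states A"
  shows "paths_from A p [] = {[]}"
proof -
  have "ts = []" if "is_path A p ts" "derived_string ts = []" for ts
  proof (cases ts)
    case (Cons t ts')
    obtain p' q z where "t = (p', q, z)" by (cases t)
    then show ?thesis
      using that Cons assms(1) by (cases z) (auto simp: epsilon_free_def)
  qed simp
  then show ?thesis
    using assms(2) by (auto simp: paths_from_def)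
qed

text \<open>Without epsilon-transitions the first transition must read \<open>a\<close>. The pairs
  are restricted to nonzero weights because \<open>is_path\<close> rejects the others.\<close>

lemma paths_from_Cons:
  assumes "epsilon_free A" "p \<in> states A" "a \<in> alphabet A"
  shows "paths_from A p (a # x) =
    (\<lambda>(q, ts). (p, q, Some a) # ts) `
      (SIGMA q:{q \<in> states A. tweight A p q (Some a) \<noteq> 0}. paths_from A q x)"
    (is "?L = ?R")
proof
  show "?L \<subseteq> ?R"
  proof
    fix ts assume ts: "ts \<in> ?L"
    then obtain t ts' where "ts = t # ts'"
      by (cases ts) (auto simp: paths_from_def)
    moreover obtain p' q z where "t = (p', q, z)" by (cases t)
    ultimately show "ts \<in> ?R"
      using ts assms(1)
      by (cases z) (auto simp: paths_from_def epsilon_free_def image_iff dest: is_path_start)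
  qed
  show "?R \<subseteq> ?L"
    using assms(2,3) by (auto simp: paths_from_def)
qed

lemma finite_paths_from:
  assumes "epsilon_free A" "finite (states A)" "x \<in> lists (alphabet A)" "p \<in> states A"
  shows "finite (paths_from A p x)"
  using assms(3,4)
proof (induction x arbitrary: p rule: list.induct)
  case Nil
  then show ?case by (simp add: paths_from_Nil assms(1))
next
  case (Cons a x)
  have "finite (SIGMA q:{q \<in> states A. tweight A p q (Some a) \<noteq> 0}. paths_from A q x)"
    using assms(2) Cons by (intro finite_SigmaI) auto
  then show ?case
    using Cons paths_from_Cons[OF assms(1) Cons.prems(2), of a x] by simp
qed

lemma sum_suffix_score_Cons:
  assumes "epsilon_free A" "finite (states A)" "a # x \<in> lists (alphabet A)" "p \<in> states A"
  shows "(\<Sum>ts\<in>paths_from A p (a # x). suffix_score A p ts) =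
    (\<Sum>q\<in>states A. tweight A p q (Some a) * (\<Sum>ts\<in>paths_from A q x. suffix_score A q ts))"
proof -
  let ?S = "{q \<in> states A. tweight A p q (Some a) \<noteq> 0}"
  have inj: "inj_on (\<lambda>(q, ts). (p, q, Some a) # ts) (SIGMA q:?S. paths_from A q x)"
    by (auto simp: inj_on_def)
  have "(\<Sum>ts\<in>paths_from A p (a # x). suffix_score A p ts) =
      (\<Sum>(q, ts)\<in>(SIGMA q:?S. paths_from A q x). tweight A p q (Some a) * suffix_score A q ts)"
    using assms(3)
    by (simp add: paths_from_Cons[OF assms(1,4)] sum.reindex[OF inj])
      (auto simp: suffix_score_def mult.assoc intro!: sum.cong)
  also have "\<dots> = (\<Sum>q\<in>?S. \<Sum>ts\<in>paths_from A q x. tweight A p q (Some a) * suffix_score A q ts)"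
    using assms finite_paths_from[OF assms(1,2)] by (intro sum.Sigma[symmetric]) auto
  \<comment> \<open>States reached with weight 0 start no admissible path here, but their terms
    vanish, so the sum may run over all states.\<close>
  also have "\<dots> = (\<Sum>q\<in>states A.
      tweight A p q (Some a) * (\<Sum>ts\<in>paths_from A q x. suffix_score A q ts))"
    using assms(2) by (intro sum.mono_neutral_cong_left) (auto simp: sum_distrib_left)
  finally show ?thesis .
qed

text \<open>Both sides are the row vector \<open>\<alpha>\<close> times the transition matrices of
  \<open>x\<close> times the column of final weights, evaluated from the right end and from the left
  end respectively. The vector \<open>\<alpha>\<close> stays general in the induction since every
  symbol replaces it.\<close>

lemma sum_suffix_score_eq_forward:
  assumes "epsilon_free A" "finite (states A)" "x \<in> lists (alphabet A)"
  shows "(\<Sum>p\<in>states A. \<alpha> p * (\<Sum>ts\<in>paths_from A p x. suffix_score A p ts)) =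
    (\<Sum>p\<in>states A. foldl (forward_step A) \<alpha> x p * fweight A p)"
  using assms(3)
proof (induction x arbitrary: \<alpha> rule: list.induct)
  case Nil
  then show ?case by (simp add: paths_from_Nil assms(1) suffix_score_def)
next
  case (Cons a x)
  let ?s = "\<lambda>q. \<Sum>ts\<in>paths_from A q x. suffix_score A q ts"
  have "(\<Sum>p\<in>states A. \<alpha> p * (\<Sum>ts\<in>paths_from A p (a # x). suffix_score A p ts)) =
      (\<Sum>p\<in>states A. \<Sum>q\<in>states A. \<alpha> p * tweight A p q (Some a) * ?s q)"
    by (intro sum.cong refl, subst sum_suffix_score_Cons[OF assms(1,2) Cons.prems])
      (simp_all add: sum_distrib_left mult.assoc)
  also have "\<dots> = (\<Sum>q\<in>states A. forward_step A \<alpha> a q * ?s q)"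
    by (subst sum.swap) (simp add: forward_step_def sum_distrib_right)
  also have "\<dots> = (\<Sum>p\<in>states A. foldl (forward_step A) \<alpha> (a # x) p * fweight A p)"
    using Cons by simp
  finally show ?case .
qed

lemma finite_string_paths:
  assumes "epsilon_free A" "finite (states A)" "x \<in> lists (alphabet A)"
  shows "finite (string_paths A x)"
  using assms by (auto simp: string_paths_eq_Sigma intro!: finite_SigmaI finite_paths_from)

lemma string_score_eq_forward:
  assumes "epsilon_free A" "finite (states A)" "x \<in> lists (alphabet A)"
  shows "string_score A x =
    (\<Sum>p\<in>states A. foldl (forward_step A) (iweight A) x p * fweight A p)"
proof -
  have "string_score A x =
      (\<Sum>p\<in>states A. \<Sum>ts\<in>paths_from A p x. iweight A p * suffix_score A p ts)"
    unfolding string_score_def string_paths_eq_Sigma path_score_def suffix_score_def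
    using assms by (subst sum.Sigma) (auto simp: mult.assoc intro: finite_paths_from)
  then show ?thesis
    by (simp add: sum_suffix_score_eq_forward[OF assms] flip: sum_distrib_left)
qed

text \<open>The second index of \<open>u\<close> is the target state, so only indices from 1 on
  occur, as in the numbering of the \<open>rcnn_input\<close> vectors.\<close>

definition chain_wfsa ::
    "'a set \<Rightarrow> nat \<Rightarrow> ('a \<Rightarrow> 'k) \<Rightarrow> ('a \<Rightarrow> nat \<Rightarrow> 'k) \<Rightarrow> ('a, nat, 'k::semiring_1) wfsa" where
  "chain_wfsa \<Sigma> n l u =
     \<lparr>alphabet = \<Sigma>, states = {..n},
      tweight = (\<lambda>p q z. case z of None \<Rightarrow> 0 | Some a \<Rightarrow>
        if q = p then (if p = 0 then 1 else l a) else if q = Suc p then u a q else 0),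
      iweight = (\<lambda>q. if q = 0 then 1 else 0),
      fweight = (\<lambda>q. if q = n then 1 else 0)\<rparr>"

lemma chain_wfsa_simps [simp]:
  "alphabet (chain_wfsa \<Sigma> n l u) = \<Sigma>"
  "states (chain_wfsa \<Sigma> n l u) = {..n}"
  "iweight (chain_wfsa \<Sigma> n l u) = (\<lambda>q. if q = 0 then 1 else 0)"
  "fweight (chain_wfsa \<Sigma> n l u) = (\<lambda>q. if q = n then 1 else 0)"
  by (simp_all add: chain_wfsa_def)

lemma epsilon_free_chain_wfsa: "epsilon_free (chain_wfsa \<Sigma> n l u)"
  by (simp add: epsilon_free_def chain_wfsa_def)

lemma forward_step_chain_wfsa_0:
  "forward_step (chain_wfsa \<Sigma> n l u) \<alpha> a 0 = \<alpha> 0"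
proof -
  have "forward_step (chain_wfsa \<Sigma> n l u) \<alpha> a 0 = (\<Sum>p\<le>n. if p = 0 then \<alpha> 0 else 0)"
    unfolding forward_step_def by (intro sum.cong) (auto simp: chain_wfsa_def)
  then show ?thesis by simp
qed

text \<open>Only the loop and the edge from the preceding state enter \<open>Suc j\<close>; the
  bound puts both sources among the states.\<close>

lemma forward_step_chain_wfsa_Suc:
  assumes "Suc j \<le> n"
  shows "forward_step (chain_wfsa \<Sigma> n l u) \<alpha> a (Suc j) = \<alpha> (Suc j) * l a + \<alpha> j * u a (Suc j)"
proof -
  have "forward_step (chain_wfsa \<Sigma> n l u) \<alpha> a (Suc j) =
      (\<Sum>p\<le>n. (if p = Suc j then \<alpha> p * l a else 0) + (if p = j then \<alpha> p * u a (Suc j) else 0))"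
    unfolding forward_step_def by (intro sum.cong) (auto simp: chain_wfsa_def)
  then show ?thesis
    using assms by (simp add: sum.distrib)
qed

lemma string_score_chain_wfsa:
  assumes "x \<in> lists \<Sigma>"
  shows "string_score (chain_wfsa \<Sigma> n l u) x =
    foldl (forward_step (chain_wfsa \<Sigma> n l u)) (\<lambda>q. if q = 0 then 1 else 0) x n"
  using string_score_eq_forward[OF epsilon_free_chain_wfsa[of \<Sigma> n l u]] assms
  by (simp add: if_distrib cong: if_cong)

text \<open>State 0 needs a separate case: its forward weight is 1, while \<open>rcnn_state\<close>
  at index 0 has the value 0.\<close>

lemma rcnn_state_eq_forward:
  fixes W :: "nat \<Rightarrow> real ^ 'm ^ 'd"
  assumes lam: "\<And>t. t < length x \<Longrightarrow> lam x (Suc t) = f (x ! t)"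
    and "t \<le> length x" "j \<le> n"
  shows "foldl (forward_step (chain_wfsa \<Sigma> n (\<lambda>a. f a $ i)
        (\<lambda>a j. rcnn_input g W b (f a) (v a) j $ i)))
      (\<lambda>q. if q = 0 then 1 else 0) (take t x) j =
    (if j = 0 then 1 else rcnn_state g W b v lam x t j $ i)"
  using assms(2,3)
proof (induction t arbitrary: j)
  case 0
  then show ?case by simp
next
  case (Suc t)
  have "t < length x" using Suc.prems by simp
  then show ?case
    using Suc
    \<comment> \<open>For index 1 the factor 1 from state 0 turns the product with \<open>u\<close>
      into the bare input term of the first layer equation.\<close>
    by (cases j)
      (simp_all add: take_Suc_conv_app_nth forward_step_chain_wfsa_0
        forward_step_chain_wfsa_Suc lam)
qed

theorem proposition12:
  fixes n :: nat
    and \<Sigma> :: "'a set"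
    and v :: "'a \<Rightarrow> real ^ 'm"
    and W :: "nat \<Rightarrow> real ^ 'm ^ 'd"
    and b :: "nat \<Rightarrow> real ^ 'd"
    and g :: "real \<Rightarrow> real"
    and lam :: "'a list \<Rightarrow> nat \<Rightarrow> real ^ 'd"
  assumes "n \<ge> 1"
    and "finite \<Sigma>"
    and "(\<exists>l. \<forall>x\<in>lists \<Sigma>. \<forall>t\<in>{1..length x}. lam x t = l) \<or>
         (\<exists>f. \<forall>x\<in>lists \<Sigma>. \<forall>t\<in>{1..length x}. lam x t = f (x ! (t - 1)))"
  shows "rational_recurrence \<Sigma> (rcnn n g W b v lam)"
proof -
  obtain f where f: "\<forall>x\<in>lists \<Sigma>. \<forall>t\<in>{1..length x}. lam x t = f (x ! (t - 1))"
    using assms(3)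
  proof
    assume "\<exists>l. \<forall>x\<in>lists \<Sigma>. \<forall>t\<in>{1..length x}. lam x t = l"
    then obtain l where "\<forall>x\<in>lists \<Sigma>. \<forall>t\<in>{1..length x}. lam x t = l" ..
    \<comment> \<open>A constant vector is a function of the symbol that ignores its
      argument.\<close>
    then show thesis by (rule that[of "\<lambda>_. l"])
  qed (auto intro: that)
  have lam: "lam x (Suc t) = f (x ! t)" if "x \<in> lists \<Sigma>" "t < length x" for x t
    using bspec[OF bspec[OF f that(1)], of "Suc t"] that(2) by simp
  \<comment> \<open>All products in the recurrence are elementwise, so each coordinate has its own
    chain. Replacing \<open>lam\<close> by \<open>f\<close> makes every weight depend on the symbol
    alone.\<close>
  define A where "A i = chain_wfsa \<Sigma> n (\<lambda>a. f a $ i)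
    (\<lambda>a j. rcnn_input g W b (f a) (v a) j $ i)" for i
  have "is_wfsa (A i)" "alphabet (A i) = \<Sigma>" for i
    using assms(2) by (simp_all add: A_def is_wfsa_def)
  moreover have "finite (string_paths (A i) x)" if "x \<in> lists \<Sigma>" for i x
    using that unfolding A_def by (intro finite_string_paths epsilon_free_chain_wfsa) simp_all
  \<comment> \<open>Here \<open>n \<ge> 1\<close> keeps the final state apart from state 0, whose
    forward weight is no RCNN coordinate.\<close>
  moreover have "rcnn n g W b v lam x $ i = string_score (A i) x" if "x \<in> lists \<Sigma>" for i x
    using rcnn_state_eq_forward[where x = x and lam = lam and f = f and t = "length x" and j = n
        and n = n and \<Sigma> = \<Sigma> and i = i and g = g and W = W and b = b and v = v] lam that assms(1)
    by (simp add: A_def string_score_chain_wfsa rcnn_def)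
  ultimately show ?thesis
    unfolding rational_recurrence_def by blast
qed

end
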